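(* Let $X$ be a normed linear space, let $E \subseteq X$ be nonempty and $q$-starshaped (with star-center $q\in E$), and let $A,B,S,T:E\to E$ be maps satisfying: (i) $A(E)\subseteq T(E)$ and $B(E)\subseteq S(E)$; (ii) for all $x,y\in E$, $$\begin{aligned}\|Ax-By\|^{2} \le{}& c_{1}\max\{[\delta(Sx,[q,Ax])]^{2},\,[\delta(Ty,[q,By])]^{2},\,\|Sx-Ty\|^{2}\}\\ &+c_{2}\max\{\delta(Sx,[q,Ax])\,\delta(Sx,[q,By]),\ \delta(Ty,[q,By])\,\delta(Ty,[q,Ax])\}\\ &+c_{3}\,\delta(Sx,[q,By])\,\delta(Ty,[q,Ax]),\end{aligned}$$ where $c_1,c_2,c_3\ge 0$ are constants with $c_1+2c_2=1$ and $c_1+c_3=1$; (iii) either both pairs $(A,S)$ and $(B,T)$ are reciprocally continuous on $E$, or both pairs $(A,T)$ and $(B,S)$ are reciprocally continuous on $E$; (iv) both pairs $(A,S)$ and $(B,T)$ are $C_q$-commuting on $E$, and $S$ and $T$ are $q$-affine. If either $S(E)$ or $T(E)$ is compact, then $F(A)\cap F(B)\cap F(S)\cap F(T)\neq\emptyset$.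
   Context: For a selfmap $f$, $F(f)$ denotes its set of fixed points. For $x\in X$ and nonempty $C\subseteq X$, $\delta(x,C)=\inf\{\|x-z\|:z\in C\}$. For $q,x\in X$, $[q,x]=\{\lambda x+(1-\lambda)q:0\le\lambda\le 1\}$ is the line segment joining $q$ to $x$. A set $E\subseteq X$ is $q$-starshaped if $q\in E$ and $\lambda x+(1-\lambda)q\in E$ for all $x\in E$ and $0<\lambda<1$; $q$ is called the star-center. For $E$ $q$-starshaped, a map $f:E\to E$ is $q$-affine if $f(\lambda x+(1-\lambda)q)=\lambda f(x)+(1-\lambda)q$ for all $x\in E$ and $\lambda\in(0,1)$. A pair $(f,g)$ of selfmaps of $E$ is reciprocally continuous on $E$ if $\lim_n fg x_n=f t$ and $\lim_n gf x_n=g t$ whenever $\{x_n\}$ is a sequence in $E$ with $\lim_n f x_n=\lim_n g x_n=t$ for some $t\in E$. A pair $(f,g)$ of selfmaps of a $q$-starshaped set $E$ is $C_q$-commuting if $fgx=gfx$ for all $x\in C_q(f,g)$, where $C_q(f,g)=\bigcup_{k\in[0,1]}\{x\in E: fx=kgx+(1-k)q\}$.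
   Formalization: In (iv) the order of each pair is reversed: C_q-commuting is assumed for (S,A) and (T,B), so ASx=SAx whenever Sx=kAx+(1-k)q and BTx=TBx whenever Tx=kBx+(1-k)q; with the order (A,S), (B,T) as written, the claim is false. *)

theory Defs
  imports "HOL-Analysis.Analysis"
begin

text \<open>
  Selfmaps of a set \<open>E\<close> are rendered as total functions \<open>f\<close> with \<open>f \<in> E \<rightarrow> E\<close>; all notions
  below only look at the values of \<open>f\<close> on \<open>E\<close>. The distance of a point \<open>x\<close> to a nonempty
  set \<open>C\<close> is \<^const>\<open>infdist\<close>, and the segment \<open>[q, x]\<close> is \<^const>\<open>closed_segment\<close>.
\<close>

definition fixed_points :: "'a set \<Rightarrow> ('a \<Rightarrow> 'a) \<Rightarrow> 'a set" where
  "fixed_points E f = {x \<in> E. f x = x}"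

definition q_starshaped :: "'a::real_vector \<Rightarrow> 'a set \<Rightarrow> bool" where
  "q_starshaped q E \<longleftrightarrow>
     q \<in> E \<and> (\<forall>x\<in>E. \<forall>l::real. 0 < l \<and> l < 1 \<longrightarrow> l *\<^sub>R x + (1 - l) *\<^sub>R q \<in> E)"

definition q_affine :: "'a::real_vector \<Rightarrow> 'a set \<Rightarrow> ('a \<Rightarrow> 'a) \<Rightarrow> bool" where
  "q_affine q E f \<longleftrightarrow>
     (\<forall>x\<in>E. \<forall>l::real. 0 < l \<and> l < 1 \<longrightarrow>
        f (l *\<^sub>R x + (1 - l) *\<^sub>R q) = l *\<^sub>R f x + (1 - l) *\<^sub>R q)"

definition reciprocally_continuous ::
    "'a::topological_space set \<Rightarrow> ('a \<Rightarrow> 'a) \<Rightarrow> ('a \<Rightarrow> 'a) \<Rightarrow> bool" where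
  "reciprocally_continuous E f g \<longleftrightarrow>
     (\<forall>(x::nat \<Rightarrow> 'a) t.
        (\<forall>n. x n \<in> E) \<and> t \<in> E \<and>
        (\<lambda>n. f (x n)) \<longlonglongrightarrow> t \<and> (\<lambda>n. g (x n)) \<longlonglongrightarrow> t \<longrightarrow>
        (\<lambda>n. f (g (x n))) \<longlonglongrightarrow> f t \<and> (\<lambda>n. g (f (x n))) \<longlonglongrightarrow> g t)"

definition Cq_set ::
    "'a::real_vector \<Rightarrow> 'a set \<Rightarrow> ('a \<Rightarrow> 'a) \<Rightarrow> ('a \<Rightarrow> 'a) \<Rightarrow> 'a set" where
  "Cq_set q E f g = (\<Union>k\<in>{0..1::real}. {x \<in> E. f x = k *\<^sub>R g x + (1 - k) *\<^sub>R q})"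

text \<open>
  This is not symmetric in \<open>f\<close> and \<open>g\<close>: the point \<open>f x\<close> lies on the segment from \<open>q\<close>
  to \<open>g x\<close>. In the usual convention \<open>f\<close> is the \<open>q\<close>-affine map of the pair, so that
  \<open>x \<in> Cq_set q E f g\<close> says that \<open>x\<close> is a coincidence point of \<open>f\<close> and some
  \<open>g\<^sub>k = k g + (1 - k) q\<close>; pairs have to be passed in this order.
\<close>

definition Cq_commuting ::
    "'a::real_vector \<Rightarrow> 'a set \<Rightarrow> ('a \<Rightarrow> 'a) \<Rightarrow> ('a \<Rightarrow> 'a) \<Rightarrow> bool" where
  "Cq_commuting q E f g \<longleftrightarrow> (\<forall>x \<in> Cq_set q E f g. f (g x) = g (f x))"

end

theory Submission
  imports Defs
begin

text \<open>
  For \<open>0 < k < 1\<close> the maps \<open>k A + (1 - k) q\<close> and \<open>k B + (1 - k) q\<close> satisfy a strict version of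
  the inequality, in which each distance to a segment is replaced by the distance to a point of
  that segment. Alternating between the two maps produces points \<open>x\<close> whose images under \<open>S\<close> and
  \<open>k A + (1 - k) q\<close> are arbitrarily close; compactness then yields coincidence points, and
  commutation there turns their common value into a common fixed point of the two maps, \<open>S\<close> and
  \<open>T\<close>. Letting \<open>k\<close> tend to \<open>1\<close>, these fixed points accumulate at some \<open>z\<close>, which reciprocal
  continuity identifies as a common fixed point of the original maps.
\<close>

section \<open>Contractive pairs in a metric space\<close>

text \<open>The right-hand side of the contractive inequality with the segments shrunk to points:
  \<open>s\<close>, \<open>t\<close> stand for \<open>S x\<close>, \<open>T y\<close>, and
  \<open>a\<close>, \<open>b\<close> for chosen points of the segments from \<open>q\<close> to
  \<open>A x\<close> and to \<open>B y\<close>.\<close>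

definition ctrl :: "real \<Rightarrow> real \<Rightarrow> real \<Rightarrow> 'a::metric_space \<Rightarrow> 'a \<Rightarrow> 'a \<Rightarrow> 'a \<Rightarrow> real" where
  "ctrl c1 c2 c3 s a t b =
     c1 * max (max ((dist s a)\<^sup>2) ((dist t b)\<^sup>2)) ((dist s t)\<^sup>2)
   + c2 * max (dist s a * dist s b) (dist t b * dist t a)
   + c3 * (dist s b * dist t a)"

lemma ctrl_swap: "ctrl c1 c2 c3 s a t b = ctrl c1 c2 c3 t b s a"
  unfolding ctrl_def by (simp add: max.commute dist_commute mult.commute)

text \<open>With \<open>t = a\<close> the \<open>c3\<close> term vanishes, and the triangle
  inequality bounds \<open>dist s b\<close> by twice the larger of \<open>dist s a\<close> and
  \<open>dist a b\<close>; this is where \<open>c1 + 2 * c2\<close> arises. The larger one cannot be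
  \<open>dist a b\<close> alone, since a positive square is not at most \<open>l\<close> times
  itself.\<close>

lemma ctrl_chain_bound:
  assumes "0 \<le> c1" "0 \<le> c2" "c1 + 2 * c2 \<le> 1" "0 \<le> l" "l < 1"
    and le: "(dist a b)\<^sup>2 \<le> l * ctrl c1 c2 c3 s a a b"
  shows "(dist a b)\<^sup>2 \<le> l * (dist s a)\<^sup>2"
proof -
  define m where "m = max (dist s a) (dist a b)"
  have m: "dist s a \<le> m" "dist a b \<le> m" "0 \<le> m"
    unfolding m_def by (auto simp: le_max_iff_disj)
  have sb: "dist s b \<le> 2 * m"
    using dist_triangle[of s b a] m by linarith
  have "max (max ((dist s a)\<^sup>2) ((dist a b)\<^sup>2)) ((dist s a)\<^sup>2) \<le> m\<^sup>2"
    using m by (auto intro: power_mono)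
  moreover have "max (dist s a * dist s b) (dist a b * dist a a) \<le> 2 * m\<^sup>2"
    using mult_mono[OF m(1) sb] m by (auto simp: power2_eq_square)
  ultimately have "ctrl c1 c2 c3 s a a b \<le> c1 * m\<^sup>2 + c2 * (2 * m\<^sup>2)"
    unfolding ctrl_def using assms(1,2) by (auto intro!: add_mono mult_left_mono)
  also have "\<dots> = (c1 + 2 * c2) * m\<^sup>2"
    by (simp add: algebra_simps)
  also have "\<dots> \<le> 1 * m\<^sup>2"
    using assms(3) by (intro mult_right_mono) auto
  finally have lm: "(dist a b)\<^sup>2 \<le> l * m\<^sup>2"
    using le assms(4) by (metis mult.left_neutral mult_left_mono order_trans)
  show ?thesis
  proof (cases "dist a b \<le> dist s a")
    case True
    then show ?thesis using lm by (simp add: m_def max_def split: if_splits)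
  next
    case False
    then have "m = dist a b" and "0 < (dist a b)\<^sup>2"
      by (auto simp: m_def)
    then show ?thesis
      using lm \<open>l < 1\<close> by (smt (verit) mult_less_cancel_right2)
  qed
qed

lemma coincidence_point:
  fixes A B S T :: "'a::metric_space \<Rightarrow> 'a"
  assumes "E \<noteq> {}" and AT: "A ` E \<subseteq> T ` E" and BS: "B ` E \<subseteq> S ` E"
    and c: "0 \<le> c1" "0 \<le> c2" "c1 + 2 * c2 \<le> 1" and l: "0 \<le> l" "l < 1"
    and contr: "\<And>x y. x \<in> E \<Longrightarrow> y \<in> E \<Longrightarrow>
        (dist (A x) (B y))\<^sup>2 \<le> l * ctrl c1 c2 c3 (S x) (A x) (T y) (B y)"
    and cpt: "compact (S ` E)"
  shows "\<exists>u\<in>E. \<exists>v\<in>E. A u = S u \<and> T v = S u \<and> B v = S u"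
proof -
  have step: "(dist (A x) (B y))\<^sup>2 \<le> l * (dist (S x) (A x))\<^sup>2"
    if "x \<in> E" "y \<in> E" "T y = A x" for x y
    using ctrl_chain_bound[OF c l] contr[OF that(1,2)] that(3) by metis
  have step': "(dist (A x) (B y))\<^sup>2 \<le> l * (dist (T y) (B y))\<^sup>2"
    if "x \<in> E" "y \<in> E" "S x = B y" for x y
    using ctrl_chain_bound[OF c l] contr[OF that(1,2)] that(3)
    by (metis ctrl_swap dist_commute)
  obtain x0 where x0: "x0 \<in> E" using \<open>E \<noteq> {}\<close> by blast
  define D where "D = (dist (S x0) (A x0))\<^sup>2"
  \<comment> \<open>The points for different \<open>n\<close> may be unrelated: convergence will
    come from compactness, not from a Cauchy argument.\<close>
  have "\<exists>x\<in>E. (dist (S x) (A x))\<^sup>2 \<le> l ^ n * D" for n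
  proof (induction n)
    case 0
    then show ?case using x0 by (auto simp: D_def)
  next
    case (Suc n)
    then obtain x where x: "x \<in> E" "(dist (S x) (A x))\<^sup>2 \<le> l ^ n * D" by blast
    obtain y where y: "y \<in> E" "T y = A x" using AT x(1) by force
    obtain x' where x': "x' \<in> E" "S x' = B y" using BS y(1) by force
    have "(dist (S x') (A x'))\<^sup>2 \<le> l * (dist (A x) (B y))\<^sup>2"
      using step'[OF x'(1) y(1) x'(2)] x'(2) y(2) by (simp add: dist_commute)
    \<comment> \<open>Each round offers two factors \<open>l\<close>; one is enough for the
      decay.\<close>
    also have "\<dots> \<le> 1 * (dist (A x) (B y))\<^sup>2"
      using l by (intro mult_right_mono) auto
    also have "\<dots> \<le> l * (dist (S x) (A x))\<^sup>2"
      using step[OF x(1) y] by simp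
    also have "\<dots> \<le> l * (l ^ n * D)"
      using x(2) l(1) by (rule mult_left_mono)
    finally have "(dist (S x') (A x'))\<^sup>2 \<le> l ^ Suc n * D"
      by (simp add: mult.assoc)
    then show ?case using x'(1) by blast
  qed
  then obtain x where x: "\<And>n. x n \<in> E" "\<And>n. (dist (S (x n)) (A (x n)))\<^sup>2 \<le> l ^ n * D"
    by metis
  have "\<exists>y\<in>E. T y = A (x n)" for n using AT x(1)[of n] by force
  then obtain y where y: "\<And>n. y n \<in> E" "\<And>n. T (y n) = A (x n)"
    by metis
  have "(\<lambda>n. (dist (T (y n)) (B (y n)))\<^sup>2) \<longlonglongrightarrow> 0"
  proof (rule tendsto_sandwich[of "\<lambda>_. 0"])
    show "(\<lambda>n. l * (l ^ n * D)) \<longlonglongrightarrow> 0"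
      using tendsto_mult_left[OF tendsto_mult_left_zero[OF LIMSEQ_realpow_zero[OF l]], of l D]
      by simp
    show "\<forall>\<^sub>F n in sequentially. (dist (T (y n)) (B (y n)))\<^sup>2 \<le> l * (l ^ n * D)"
    proof (intro always_eventually allI)
      fix n
      have "(dist (A (x n)) (B (y n)))\<^sup>2 \<le> l * (dist (S (x n)) (A (x n)))\<^sup>2"
        using step[OF x(1) y] .
      also have "\<dots> \<le> l * (l ^ n * D)"
        using x(2) l(1) by (rule mult_left_mono)
      finally show "(dist (T (y n)) (B (y n)))\<^sup>2 \<le> l * (l ^ n * D)"
        by (simp only: y(2))
    qed
  qed (auto simp: always_eventually)
  then have TB: "(\<lambda>n. dist (T (y n)) (B (y n))) \<longlonglongrightarrow> 0"
    by simp
  have "\<forall>n. B (y n) \<in> S ` E" using BS y(1) by blast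
  then obtain z r where z: "z \<in> S ` E" and r: "strict_mono (r :: nat \<Rightarrow> nat)"
    and lim: "((\<lambda>n. B (y n)) \<circ> r) \<longlonglongrightarrow> z"
    using cpt unfolding compact_def by metis
  have Blim: "(\<lambda>n. B (y (r n))) \<longlonglongrightarrow> z"
    using lim by (simp add: o_def)
  have "(\<lambda>n. dist (T (y (r n))) (B (y (r n)))) \<longlonglongrightarrow> 0"
    using LIMSEQ_subseq_LIMSEQ[OF TB r] by (simp add: o_def)
  from tendsto_add[OF this Blim[unfolded tendsto_dist_iff[of _ z]]]
  have "(\<lambda>n. dist (T (y (r n))) (B (y (r n))) + dist (B (y (r n))) z) \<longlonglongrightarrow> 0"
    by simp
  then have "(\<lambda>n. dist (T (y (r n))) z) \<longlonglongrightarrow> 0"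
    by (rule tendsto_0_le[where K = 1]) (simp add: dist_triangle always_eventually)
  then have Tlim: "(\<lambda>n. T (y (r n))) \<longlonglongrightarrow> z"
    by (simp only: tendsto_dist_iff[of _ z])
  obtain u where u: "u \<in> E" "S u = z" using z by blast
  \<comment> \<open>The limit is taken in \<open>y\<close> only, with \<open>u\<close> fixed, so
    continuity of the maps does not enter. With \<open>S u = z\<close>, every term of the limit
    vanishes except \<open>c1\<close> times the squared distance.\<close>
  have "(dist (A u) z)\<^sup>2 \<le> l * ctrl c1 c2 c3 (S u) (A u) z z"
  proof (rule LIMSEQ_le)
    show "(\<lambda>n. (dist (A u) (B (y (r n))))\<^sup>2) \<longlonglongrightarrow> (dist (A u) z)\<^sup>2"
      by (intro tendsto_intros Blim)
    show "(\<lambda>n. l * ctrl c1 c2 c3 (S u) (A u) (T (y (r n))) (B (y (r n))))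
            \<longlonglongrightarrow> l * ctrl c1 c2 c3 (S u) (A u) z z"
      unfolding ctrl_def by (intro tendsto_intros tendsto_max Blim Tlim)
  qed (use contr u y in blast)
  also have "\<dots> = (l * c1) * (dist (A u) z)\<^sup>2"
    unfolding u(2) ctrl_def by (simp add: dist_commute max_def)
  finally have "(dist (A u) z)\<^sup>2 \<le> (l * c1) * (dist (A u) z)\<^sup>2" .
  moreover have lc1: "l * c1 < 1"
    using c l by (smt (verit) mult_left_le)
  ultimately have Au: "A u = z"
    by (smt (verit) mult_less_cancel_right2 zero_less_power2 zero_less_dist_iff)
  obtain v where v: "v \<in> E" "T v = z" using Au u(1) AT by force
  have "(dist z (B v))\<^sup>2 \<le> (l * c1) * (dist z (B v))\<^sup>2"
    using contr[OF u(1) v(1)] unfolding Au u(2) v(2) ctrl_def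
    by (simp add: max_def split: if_splits)
  then have "B v = z"
    using lc1 by (smt (verit) mult_less_cancel_right2 zero_less_power2 zero_less_dist_iff)
  then show ?thesis using u v Au by (intro bexI[of _ u] bexI[of _ v]) simp_all
qed

text \<open>Commutation at \<open>u\<close> and \<open>v\<close> makes \<open>z = S u\<close> a
  coincidence point of both pairs. Comparing \<open>z\<close> with \<open>v\<close>, then
  \<open>u\<close> with \<open>z\<close>, uses \<open>ctrl\<close> with \<open>a = s\<close> and
  \<open>b = t\<close>, where it collapses to \<open>c1 + c3\<close> times the squared distance; the
  factor \<open>l\<close> then forces that distance to be zero.\<close>

lemma common_fixed_point_of_coincidence:
  fixes A B S T :: "'a::metric_space \<Rightarrow> 'a"
  assumes S: "S \<in> E \<rightarrow> E" and T: "T \<in> E \<rightarrow> E"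
    and c: "0 \<le> c1" "0 \<le> c3" "c1 + c3 \<le> 1" and l: "0 \<le> l" "l < 1"
    and contr: "\<And>x y. x \<in> E \<Longrightarrow> y \<in> E \<Longrightarrow>
        (dist (A x) (B y))\<^sup>2 \<le> l * ctrl c1 c2 c3 (S x) (A x) (T y) (B y)"
    and SA: "\<And>x. x \<in> E \<Longrightarrow> S x = A x \<Longrightarrow> S (A x) = A (S x)"
    and TB: "\<And>x. x \<in> E \<Longrightarrow> T x = B x \<Longrightarrow> T (B x) = B (T x)"
    and uv: "u \<in> E" "v \<in> E" "A u = S u" "T v = S u" "B v = S u"
  shows "\<exists>z\<in>E. A z = z \<and> B z = z \<and> S z = z \<and> T z = z"
proof -
  define z where "z = S u"
  have z: "z \<in> E" using S uv(1) by (auto simp: z_def)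
  have Sz: "S z = A z" and Tz: "T z = B z"
    using SA[OF uv(1)] TB[OF uv(2)] uv by (simp_all add: z_def)
  have zero: "p = r" if "(dist p r)\<^sup>2 \<le> l * ctrl c1 c2 c3 p p r r" for p r :: 'a
  proof (rule ccontr)
    assume "p \<noteq> r"
    then have pos: "0 < (dist p r)\<^sup>2" by simp
    have "ctrl c1 c2 c3 p p r r = (c1 + c3) * (dist p r)\<^sup>2"
      unfolding ctrl_def by (simp add: dist_commute power2_eq_square algebra_simps max_def)
    then have "(dist p r)\<^sup>2 \<le> (l * (c1 + c3)) * (dist p r)\<^sup>2"
      using that by (simp add: mult.assoc)
    moreover have "l * (c1 + c3) < 1"
      using c l by (smt (verit) mult_left_le)
    ultimately show False
      using pos by (smt (verit) mult_less_cancel_right2)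
  qed
  have "A z = z"
    using zero[of "A z" z] contr[OF z uv(2)] uv(4,5) by (simp add: Sz z_def[symmetric])
  moreover have "B z = z"
    using zero[of z "B z"] contr[OF uv(1) z] uv(3) by (simp add: Tz z_def[symmetric])
  ultimately show ?thesis using z Sz Tz by auto
qed

lemma common_fixed_point:
  fixes A B S T :: "'a::metric_space \<Rightarrow> 'a"
  assumes "E \<noteq> {}" and S: "S \<in> E \<rightarrow> E" and T: "T \<in> E \<rightarrow> E"
    and AT: "A ` E \<subseteq> T ` E" and BS: "B ` E \<subseteq> S ` E"
    and c: "0 \<le> c1" "0 \<le> c2" "0 \<le> c3" "c1 + 2 * c2 \<le> 1" "c1 + c3 \<le> 1" and l: "0 \<le> l" "l < 1"
    and contr: "\<And>x y. x \<in> E \<Longrightarrow> y \<in> E \<Longrightarrow>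
        (dist (A x) (B y))\<^sup>2 \<le> l * ctrl c1 c2 c3 (S x) (A x) (T y) (B y)"
    and SA: "\<And>x. x \<in> E \<Longrightarrow> S x = A x \<Longrightarrow> S (A x) = A (S x)"
    and TB: "\<And>x. x \<in> E \<Longrightarrow> T x = B x \<Longrightarrow> T (B x) = B (T x)"
    and cpt: "compact (S ` E) \<or> compact (T ` E)"
  shows "\<exists>z\<in>E. A z = z \<and> B z = z \<and> S z = z \<and> T z = z"
proof -
  \<comment> \<open>The inequality is invariant under exchanging \<open>(A, S)\<close> with
    \<open>(B, T)\<close>, which reduces compactness of \<open>T\<close> E\<open>to that of\<close>S
    \<open>E\<close>.\<close>
  have contr': "(dist (B x) (A y))\<^sup>2 \<le> l * ctrl c1 c2 c3 (T x) (B x) (S y) (A y)"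
    if "x \<in> E" "y \<in> E" for x y
    using contr[OF that(2,1)] by (metis ctrl_swap dist_commute)
  have "\<exists>u\<in>E. \<exists>v\<in>E. A u = S u \<and> T v = S u \<and> B v = S u"
    using cpt
  proof
    assume "compact (S ` E)"
    then show ?thesis
      using coincidence_point[OF \<open>E \<noteq> {}\<close> AT BS c(1,2,4) l contr] by blast
  next
    assume "compact (T ` E)"
    then have "\<exists>v\<in>E. \<exists>u\<in>E. B v = T v \<and> S u = T v \<and> A u = T v"
      using coincidence_point[OF \<open>E \<noteq> {}\<close> BS AT c(1,2,4) l contr'] by blast
    then show ?thesis by metis
  qed
  then obtain u v where uv: "u \<in> E" "v \<in> E" "A u = S u" "T v = S u" "B v = S u"
    by blast
  show ?thesis
    by (rule common_fixed_point_of_coincidence[OF S T c(1,3,5) l contr SA TB uv])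
qed

section \<open>Reciprocal continuity at a limit of fixed points\<close>

lemma reciprocally_continuousD:
  assumes "reciprocally_continuous E f g" "\<And>n. x n \<in> E" "t \<in> E"
    and "(\<lambda>n. f (x n)) \<longlonglongrightarrow> t" "(\<lambda>n. g (x n)) \<longlonglongrightarrow> t"
  shows "(\<lambda>n. f (g (x n))) \<longlonglongrightarrow> f t" "(\<lambda>n. g (f (x n))) \<longlonglongrightarrow> g t"
  using assms unfolding reciprocally_continuous_def by blast+

text \<open>Both compositions along \<open>x\<close> equal \<open>f (x n)\<close>, which tends to
  \<open>t\<close>; reciprocal continuity gives them the limits \<open>f t\<close> and
  \<open>g t\<close>.\<close>

lemma reciprocally_continuous_fixed_limit:
  fixes f g :: "'a::t2_space \<Rightarrow> 'a"
  assumes "reciprocally_continuous E f g" "\<And>n. x n \<in> E" "t \<in> E"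
    and "x \<longlonglongrightarrow> t" and f: "(\<lambda>n. f (x n)) \<longlonglongrightarrow> t"
    and "\<And>n. g (x n) = x n" and "\<And>n. g (f (x n)) = f (x n)"
  shows "f t = t" "g t = t"
  using reciprocally_continuousD[OF assms(1-3) f] assms(4,6,7) f
  by (auto dest: LIMSEQ_unique)

section \<open>Approximation by maps contracted towards the star-center\<close>

theorem theorem2p1:
  fixes E :: "'a::real_normed_vector set"
    and q :: 'a
    and A B S T :: "'a \<Rightarrow> 'a"
    and c1 c2 c3 :: real
  assumes nonempty: "E \<noteq> {}"
    and starshaped: "q_starshaped q E"
    and "A \<in> E \<rightarrow> E" and "B \<in> E \<rightarrow> E" and "S \<in> E \<rightarrow> E" and "T \<in> E \<rightarrow> E"
    and ranges_A: "A ` E \<subseteq> T ` E" and ranges_B: "B ` E \<subseteq> S ` E"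
    and "c1 \<ge> 0" and "c2 \<ge> 0" and "c3 \<ge> 0"
    and "c1 + 2 * c2 = 1" and "c1 + c3 = 1"
    and contractive: "\<And>x y. x \<in> E \<Longrightarrow> y \<in> E \<Longrightarrow>
      (norm (A x - B y))\<^sup>2 \<le>
        c1 * Max {(infdist (S x) (closed_segment q (A x)))\<^sup>2,
                  (infdist (T y) (closed_segment q (B y)))\<^sup>2,
                  (norm (S x - T y))\<^sup>2}
      + c2 * max (infdist (S x) (closed_segment q (A x)) * infdist (S x) (closed_segment q (B y)))
                 (infdist (T y) (closed_segment q (B y)) * infdist (T y) (closed_segment q (A x)))
      + c3 * (infdist (S x) (closed_segment q (B y)) * infdist (T y) (closed_segment q (A x)))"
    and rec_cont: "(reciprocally_continuous E A S \<and> reciprocally_continuous E B T) \<or>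
         (reciprocally_continuous E A T \<and> reciprocally_continuous E B S)"
    and Cq_SA: "Cq_commuting q E S A" and Cq_TB: "Cq_commuting q E T B"
    and "q_affine q E S" and "q_affine q E T"
    and compact_range: "compact (S ` E) \<or> compact (T ` E)"
  shows "fixed_points E A \<inter> fixed_points E B \<inter> fixed_points E S \<inter> fixed_points E T \<noteq> {}"
proof -
  define P where "P k f x = k *\<^sub>R f x + (1 - k) *\<^sub>R q" for k and f :: "'a \<Rightarrow> 'a" and x
  \<comment> \<open>If \<open>g y = f x\<close>, then q-affinity makes
    \<open>k *\<^sub>R y + (1 - k) *\<^sub>R q\<close> a preimage of \<open>P k f x\<close> under
    \<open>g\<close>.\<close>
  have P_range: "P k f ` E \<subseteq> g ` E"
    if k: "0 < k" "k < 1" and sub: "f ` E \<subseteq> g ` E" and aff: "q_affine q E g" for k f g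
  proof
    fix w assume "w \<in> P k f ` E"
    then obtain x where x: "x \<in> E" "w = P k f x" by blast
    then obtain y where y: "y \<in> E" "f x = g y" using sub by blast
    have "w = g (k *\<^sub>R y + (1 - k) *\<^sub>R q)"
      using aff k y x unfolding q_affine_def P_def by simp
    moreover have "k *\<^sub>R y + (1 - k) *\<^sub>R q \<in> E"
      using starshaped k y(1) unfolding q_starshaped_def by blast
    ultimately show "w \<in> g ` E" by blast
  qed
  \<comment> \<open>A coincidence point of \<open>g\<close> and \<open>P k f\<close> lies in
    \<open>Cq_set q E g f\<close>, so \<open>g\<close> commutes with \<open>f\<close> there;
    q-affinity of \<open>g\<close> carries this over to \<open>P k f\<close>.\<close>
  have P_comm: "g (P k f x) = P k f (g x)"
    if k: "0 < k" "k < 1" and "x \<in> E" "g x = P k f x" "Cq_commuting q E g f" "f \<in> E \<rightarrow> E"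
      "q_affine q E g" for k f g x
  proof -
    have "x \<in> Cq_set q E g f"
      using that unfolding Cq_set_def P_def by (auto intro!: bexI[of _ k])
    then have "g (f x) = f (g x)" using that(5) unfolding Cq_commuting_def by blast
    moreover have "f x \<in> E" using that(3,6) by auto
    ultimately show ?thesis
      using k that(7) unfolding q_affine_def P_def by simp
  qed
  have P_infdist: "infdist s (closed_segment q (f x)) \<le> dist s (P k f x)"
    if "0 < k" "k < 1" for k f x s
  proof (rule infdist_le)
    show "P k f x \<in> closed_segment q (f x)"
      using that unfolding P_def in_segment by (auto intro!: exI[of _ k])
  qed
  \<comment> \<open>The \<open>q\<close> parts cancel in the difference, which leaves the factor
    \<open>k\<^sup>2\<close>. On the right, \<open>P k A x\<close> and \<open>P k B y\<close> lie on
    the segments, and the bound is monotone in each distance because the coefficients are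
    nonnegative.\<close>
  have P_contr: "(dist (P k A x) (P k B y))\<^sup>2
        \<le> k\<^sup>2 * ctrl c1 c2 c3 (S x) (P k A x) (T y) (P k B y)"
    if k: "0 < k" "k < 1" and "x \<in> E" "y \<in> E" for k x y
  proof -
    note d = P_infdist[OF k] infdist_nonneg
    have "dist (P k A x) (P k B y) = norm (k *\<^sub>R (A x - B y))"
      by (simp add: P_def dist_norm algebra_simps)
    then have "(dist (P k A x) (P k B y))\<^sup>2 = k\<^sup>2 * (norm (A x - B y))\<^sup>2"
      by (simp add: power_mult_distrib)
    moreover have "(norm (A x - B y))\<^sup>2 \<le> ctrl c1 c2 c3 (S x) (P k A x) (T y) (P k B y)"
      unfolding ctrl_def dist_norm[of "S x" "T y"]
      by (rule order_trans[OF contractive[OF that(3,4)]])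
        (auto intro!: add_mono mult_left_mono mult_mono max.mono power_mono d
          simp: max.assoc simp del: max.bounded_iff
          simp: \<open>c1 \<ge> 0\<close> \<open>c2 \<ge> 0\<close> \<open>c3 \<ge> 0\<close>)
    ultimately show ?thesis by (simp add: mult_left_mono)
  qed
  have fp: "\<exists>z\<in>E. P k A z = z \<and> P k B z = z \<and> S z = z \<and> T z = z"
    if k: "0 < k" "k < 1" for k
  proof (rule common_fixed_point[of E S T "P k A" "P k B" c1 c2 c3 "k\<^sup>2"])
    show "k\<^sup>2 < 1" using k by (simp add: power2_less_1_iff)
    show "\<And>x. x \<in> E \<Longrightarrow> S x = P k A x \<Longrightarrow> S (P k A x) = P k A (S x)"
      by (rule P_comm[OF k _ _ Cq_SA \<open>A \<in> E \<rightarrow> E\<close> \<open>q_affine q E S\<close>])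
    show "\<And>x. x \<in> E \<Longrightarrow> T x = P k B x \<Longrightarrow> T (P k B x) = P k B (T x)"
      by (rule P_comm[OF k _ _ Cq_TB \<open>B \<in> E \<rightarrow> E\<close> \<open>q_affine q E T\<close>])
    show "P k A ` E \<subseteq> T ` E" "P k B ` E \<subseteq> S ` E"
      using P_range[OF k] ranges_A ranges_B \<open>q_affine q E S\<close> \<open>q_affine q E T\<close> by blast+
  qed (simp_all add: P_contr[OF k] compact_range nonempty \<open>S \<in> E \<rightarrow> E\<close> \<open>T \<in> E \<rightarrow> E\<close>
      \<open>c1 \<ge> 0\<close> \<open>c2 \<ge> 0\<close> \<open>c3 \<ge> 0\<close> \<open>c1 + 2 * c2 = 1\<close> \<open>c1 + c3 = 1\<close>)
  \<comment> \<open>The shift by 2 keeps \<open>k n\<close> positive already at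
    \<open>n = 0\<close>.\<close>
  define k :: "nat \<Rightarrow> real" where "k n = 1 - inverse (real (n + 2))" for n
  have k: "0 < k n" "k n < 1" for n
    unfolding k_def by (auto simp: field_simps)
  have klim: "k \<longlonglongrightarrow> 1"
    unfolding k_def
    using tendsto_diff[OF tendsto_const LIMSEQ_ignore_initial_segment[OF lim_inverse_n, of 2], of 1]
    by simp
  obtain x where x: "\<And>n. x n \<in> E" "\<And>n. P (k n) A (x n) = x n" "\<And>n. P (k n) B (x n) = x n"
      "\<And>n. S (x n) = x n" "\<And>n. T (x n) = x n"
    using fp[OF k] by metis
  \<comment> \<open>Solving the fixed point equation for \<open>f w\<close> gives a formula free of
    \<open>f\<close>: hence \<open>A\<close> and \<open>B\<close> agree at \<open>x n\<close>, and
    their values have the same limit as \<open>x n\<close> along a convergent subsequence, as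
    \<open>k n\<close> tends to 1.\<close>
  have P_inv: "f w = inverse (k n) *\<^sub>R (w - q) + q" if "P (k n) f w = w" for f n w
  proof -
    have "w - q = k n *\<^sub>R (f w - q)"
      using that unfolding P_def by (simp add: algebra_simps)
    then show ?thesis using k[of n] by simp
  qed
  have Ax: "A (x n) = inverse (k n) *\<^sub>R (x n - q) + q"
    and Bx: "B (x n) = A (x n)" for n
    using P_inv[OF x(2)] P_inv[OF x(3)] by simp_all
  \<comment> \<open>The equation \<open>S (x n) = x n = P (k n) A (x n)\<close> places
    \<open>x n\<close> in the set where \<open>S\<close> and \<open>A\<close> commute.\<close>
  have SA: "S (A (x n)) = A (x n)" for n
  proof -
    have "x n \<in> Cq_set q E S A"
      using x(1,2,4)[of n] k[of n] unfolding Cq_set_def P_def by (auto intro!: bexI[of _ "k n"])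
    then show ?thesis using Cq_SA x(4) unfolding Cq_commuting_def by metis
  qed
  have TB: "T (B (x n)) = B (x n)" for n
  proof -
    have "x n \<in> Cq_set q E T B"
      using x(1,3,5)[of n] k[of n] unfolding Cq_set_def P_def by (auto intro!: bexI[of _ "k n"])
    then show ?thesis using Cq_TB x(5) unfolding Cq_commuting_def by metis
  qed
  have "\<forall>n. x n \<in> S ` E" "\<forall>n. x n \<in> T ` E"
    using x by (metis imageI)+
  then obtain z r where z: "z \<in> S ` E \<or> z \<in> T ` E"
      and r: "strict_mono (r :: nat \<Rightarrow> nat)" and lim: "(x \<circ> r) \<longlonglongrightarrow> z"
    using compact_range unfolding compact_def by metis
  have zE: "z \<in> E" using z \<open>S \<in> E \<rightarrow> E\<close> \<open>T \<in> E \<rightarrow> E\<close> by blast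
  define w where "w n = x (r n)" for n
  have wlim: "w \<longlonglongrightarrow> z" using lim by (simp add: o_def w_def[abs_def])
  have krlim: "(\<lambda>n. k (r n)) \<longlonglongrightarrow> 1"
    using LIMSEQ_subseq_LIMSEQ[OF klim r] by (simp add: o_def)
  have "(\<lambda>n. inverse (k (r n)) *\<^sub>R (w n - q) + q) \<longlonglongrightarrow> inverse 1 *\<^sub>R (z - q) + q"
    by (intro tendsto_intros krlim wlim) simp
  then have Alim: "(\<lambda>n. A (w n)) \<longlonglongrightarrow> z"
    by (simp add: w_def Ax)
  have Blim: "(\<lambda>n. B (w n)) \<longlonglongrightarrow> z"
    using Alim by (simp add: w_def Bx)
  \<comment> \<open>The crossed identities for \<open>T\<close> with \<open>A\<close> and
    \<open>S\<close> with \<open>B\<close> follow from \<open>B (x n) = A (x n)\<close>; they serve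
    the second alternative of \<open>rec_cont\<close>.\<close>
  have w: "w n \<in> E" "S (w n) = w n" "T (w n) = w n" "S (A (w n)) = A (w n)"
      "T (B (w n)) = B (w n)" "T (A (w n)) = A (w n)" "S (B (w n)) = B (w n)" for n
    using x SA TB TB[unfolded Bx] by (auto simp: w_def Bx)
  note fixed = reciprocally_continuous_fixed_limit[OF _ w(1) zE wlim]
  have "A z = z \<and> B z = z \<and> S z = z \<and> T z = z"
    using rec_cont
  proof
    assume "reciprocally_continuous E A S \<and> reciprocally_continuous E B T"
    then show ?thesis
      using fixed[OF _ Alim w(2) w(4)] fixed[OF _ Blim w(3) w(5)] by blast
  next
    assume "reciprocally_continuous E A T \<and> reciprocally_continuous E B S"
    then show ?thesis
      using fixed[OF _ Alim w(3) w(6)] fixed[OF _ Blim w(2) w(7)] by blast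
  qed
  then show ?thesis using zE by (auto simp: fixed_points_def)
qed

end
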